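(* Let $r\ge 1$ and $s\ge 0$ be integers, $k_1,\dots,k_r$ integers, and $a,b,c$ positive real numbers. Then for every integer $n\ge 0$, $$E^{(k_1,\dots,k_r)}_n(x;a,b,c)=\sum_{m=0}^{\infty}\binom{n}{m}\sum_{l=0}^{n-m}\frac{\binom{n-m}{l}}{\binom{l+s}{l}}\left\{ l+s \atop s\right\}E^{(k_1,\dots,k_r)}_{n-m-l}(0;a,b)\,B^{(s)}_m(xr\ln c).$$
   Context: The multiple polylogarithm is the formal power series $\mathrm{Li}_{(k_1,\dots,k_r)}(z)=\sum_{0<m_1<m_2<\dots<m_r}\frac{z^{m_r}}{m_1^{k_1}m_2^{k_2}\cdots m_r^{k_r}}$. For $u>0$ write $u^{t}=e^{t\ln u}$. The generalized multi poly-Euler polynomials are defined by $$\frac{2\,\mathrm{Li}_{(k_1,\dots,k_r)}(1-(ab)^{-t})}{(a^{-t}+b^{t})^r}\,c^{rxt}=\sum_{n=0}^{\infty}E^{(k_1,\dots,k_r)}_n(x;a,b,c)\frac{t^n}{n!},$$ and $E^{(k_1,\dots,k_r)}_n(x;a,b):=E^{(k_1,\dots,k_r)}_n(x;a,b,e)$. $\left\{ n \atop m\right\}$ denotes the Stirling numbers of the second kind. The higher-order Bernoulli polynomials $B^{(s)}_m(x)$ are defined by $\left(\frac{t}{e^t-1}\right)^s e^{xt}=\sum_{m=0}^\infty B^{(s)}_m(x)\frac{t^m}{m!}$. *)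

theory Defs
  imports
    Complex_Main
    "HOL-Computational_Algebra.Formal_Power_Series"
    "HOL-Combinatorics.Stirling"
begin

text \<open>
  All generating functions are formal power series in \<open>t\<close>. The argument \<open>x\<close> of the
  polynomials ranges over an arbitrary real field, so real and complex \<open>x\<close> are covered
  simultaneously. The exponents are a nonempty list of integers \<open>[k\<^sub>1, \<dots>, k\<^sub>r]\<close>.
\<close>

definition polylog_indices :: "nat \<Rightarrow> nat \<Rightarrow> nat list set" where
  "polylog_indices r n =
     {ms. length ms = r \<and> sorted_wrt (<) ms \<and> (\<forall>m\<in>set ms. 0 < m) \<and> last ms = n}"

lemma finite_polylog_indices:
  assumes "r \<ge> 1"
  shows "finite (polylog_indices r n)"
proof (rule finite_subset)
  show "polylog_indices r n \<subseteq> {ms. set ms \<subseteq> {..n} \<and> length ms = r}"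
  proof
    fix ms assume "ms \<in> polylog_indices r n"
    hence *: "length ms = r" "sorted_wrt (<) ms" "last ms = n"
      by (auto simp: polylog_indices_def)
    from * assms have "ms \<noteq> []" by auto
    have "m \<le> n" if "m \<in> set ms" for m
    proof -
      have "sorted_wrt (<) (butlast ms @ [last ms])" using *(2) \<open>ms \<noteq> []\<close>
        by (metis append_butlast_last_id)
      moreover have "m \<in> set (butlast ms @ [last ms])" using that \<open>ms \<noteq> []\<close>
        by (metis append_butlast_last_id)
      ultimately show ?thesis using *(3) by (auto simp: sorted_wrt_append intro: less_imp_le)
    qed
    with * show "ms \<in> {ms. set ms \<subseteq> {..n} \<and> length ms = r}" by auto
  qed
  show "finite {ms. set ms \<subseteq> {..n} \<and> length ms = r}"
    by (rule finite_lists_length_eq) simp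
qed

definition multi_polylog :: "int list \<Rightarrow> 'a::field_char_0 fps" where
  "multi_polylog k = Abs_fps (\<lambda>n. \<Sum>ms\<in>polylog_indices (length k) n.
     1 / (\<Prod>i<length k. of_nat (ms ! i) powi (k ! i)))"

text \<open>\<open>fps_powr u y\<close> is \<open>u\<^sup>y\<^sup>t = exp (y t ln u)\<close> as a power series in \<open>t\<close>, for \<open>u > 0\<close>.\<close>

definition fps_powr :: "real \<Rightarrow> 'a::real_field \<Rightarrow> 'a fps" where
  "fps_powr u y = fps_exp (y * of_real (ln u))"

text \<open>
  The composition \<open>oo\<close> below is a genuine substitution, since \<open>1 - (ab)\<^sup>-\<^sup>t\<close> has
  constant term 0; the denominator has constant term \<open>2\<^sup>r\<close>, hence is invertible.
\<close>

definition multi_poly_euler_gf ::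
    "int list \<Rightarrow> 'a::real_field \<Rightarrow> real \<Rightarrow> real \<Rightarrow> real \<Rightarrow> 'a fps" where
  "multi_poly_euler_gf k x a b c =
     2 * (multi_polylog k oo (1 - fps_powr (a * b) (-1)))
       / (fps_powr a (-1) + fps_powr b 1) ^ length k
       * fps_powr c (of_nat (length k) * x)"

definition multi_poly_euler ::
    "int list \<Rightarrow> nat \<Rightarrow> 'a::real_field \<Rightarrow> real \<Rightarrow> real \<Rightarrow> real \<Rightarrow> 'a" where
  "multi_poly_euler k n x a b c = fact n * fps_nth (multi_poly_euler_gf k x a b c) n"

abbreviation multi_poly_euler_e ::
    "int list \<Rightarrow> nat \<Rightarrow> 'a::real_field \<Rightarrow> real \<Rightarrow> real \<Rightarrow> 'a" where
  "multi_poly_euler_e k n x a b \<equiv> multi_poly_euler k n x a b (exp 1)"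

lemma multi_poly_euler_gf_eq:
  "multi_poly_euler_gf k x a b c = Abs_fps (\<lambda>n. multi_poly_euler k n x a b c / fact n)"
  by (simp add: fps_eq_iff multi_poly_euler_def)

definition bernoulli_gf :: "nat \<Rightarrow> 'a::field_char_0 \<Rightarrow> 'a fps" where
  "bernoulli_gf s x = (fps_X / (fps_exp 1 - 1)) ^ s * fps_exp x"

text \<open>
  \<open>fps_exp 1 - 1\<close> is not invertible, but division of power series over a field is
  exact division whenever the subdegree of the divisor permits.
\<close>

lemma fps_X_div_exp_minus_1:
  "fps_X / (fps_exp 1 - 1) * (fps_exp 1 - 1) = (fps_X :: 'a::field_char_0 fps)"
proof -
  let ?g = "fps_exp 1 - 1 :: 'a fps"
  have "subdegree ?g = 1" by (rule subdegreeI) auto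
  moreover have "?g \<noteq> 0" using calculation by auto
  ultimately have "?g dvd fps_X" by (subst fps_dvd_iff) auto
  thus ?thesis by simp
qed

definition higher_bernoulli :: "nat \<Rightarrow> nat \<Rightarrow> 'a::field_char_0 \<Rightarrow> 'a" where
  "higher_bernoulli s m x = fact m * fps_nth (bernoulli_gf s x) m"

lemma bernoulli_gf_eq:
  "bernoulli_gf s x = Abs_fps (\<lambda>m. higher_bernoulli s m x / fact m)"
  by (simp add: fps_eq_iff higher_bernoulli_def)

end

theory Submission
  imports Defs
begin

text \<open>
  The Stirling numbers \<open>S(l + s, s)\<close> are the coefficients of \<open>((e\<^sup>t - 1) / t)\<^sup>s\<close>, which is the
  inverse of the factor \<open>(t / (e\<^sup>t - 1))\<^sup>s\<close> in the generating function of the Bernoulli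
  polynomials. Hence \<open>c\<^sup>r\<^sup>x\<^sup>t = e\<^sup>y\<^sup>t\<close> with \<open>y = x r ln c\<close> is the product of the Bernoulli and the
  Stirling series, and the theorem compares coefficients after multiplying by the generating
  function at \<open>x = 0\<close>.
\<close>

text \<open>Since \<open>f = fps_exp 1 - 1\<close> satisfies \<open>f' = f + 1\<close>,
  differentiating \<open>f ^ s\<close> yields the recurrence of the Stirling numbers, up to the
  factor \<open>fact s\<close>.\<close>

lemma fps_nth_exp_minus_1_power:
  "fact n * fps_nth ((fps_exp 1 - 1) ^ s) n
     = (fact s * of_nat (Stirling n s) :: 'a::field_char_0)"
proof (induction n arbitrary: s)
  case 0
  show ?case by (cases s) (simp_all add: fps_power_zeroth power_0_left)
next
  case (Suc n)
  show ?case
  proof (cases s)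
    case 0
    then show ?thesis by simp
  next
    case (Suc j)
    define f where "f = (fps_exp 1 - 1 :: 'a fps)"
    have deriv_f: "fps_deriv f = f + 1"
      by (simp add: f_def)
    have "fps_deriv (f ^ s) = of_nat s * (f ^ s + f ^ j)"
      using fps_deriv_power[of f s]
      by (simp add: deriv_f Suc algebra_simps flip: fps_of_nat del: fps_deriv_power)
    from arg_cong[OF this, of "\<lambda>g. fps_nth g n"]
    have "of_nat (Suc n) * fps_nth (f ^ s) (Suc n)
        = of_nat s * (fps_nth (f ^ s) n + fps_nth (f ^ j) n)"
      by (simp flip: fps_of_nat)
    then have "fact (Suc n) * fps_nth (f ^ s) (Suc n)
        = of_nat s * (fact n * fps_nth (f ^ s) n + fact n * fps_nth (f ^ j) n)"
      unfolding fact_Suc by (metis (no_types, lifting) distrib_left mult.assoc mult.commute)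
    also have "\<dots> = of_nat s * (fact s * of_nat (Stirling n s) + fact j * of_nat (Stirling n j))"
      by (simp only: Suc.IH f_def)
    also have "\<dots> = fact s * of_nat (Stirling (Suc n) s)"
      by (simp add: Suc algebra_simps)
    finally show ?thesis by (simp only: f_def)
  qed
qed

text \<open>This is ((e^t - 1)/t)^s, given by coefficients so that the quotients in the theorem
  appear literally.\<close>

definition stirling_gf :: "nat \<Rightarrow> 'a::field_char_0 fps" where
  "stirling_gf s = Abs_fps (\<lambda>l. of_nat (Stirling (l + s) s) / of_nat ((l + s) choose l) / fact l)"

text \<open>For n = l + s this is s!/(l + s)! = 1/(binom(l + s, l) l!); for n < s both coefficients
  are 0.\<close>

lemma fps_X_power_mult_stirling_gf:
  "fps_X ^ s * stirling_gf s = ((fps_exp 1 - 1) ^ s :: 'a::field_char_0 fps)"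
proof (rule fps_ext)
  fix n
  have nth: "fps_nth ((fps_exp 1 - 1) ^ s) n
      = (fact s * of_nat (Stirling n s) / fact n :: 'a)"
    using fps_nth_exp_minus_1_power[of n s, where 'a = 'a] by (simp add: field_simps)
  show "fps_nth (fps_X ^ s * stirling_gf s) n = (fps_nth ((fps_exp 1 - 1) ^ s) n :: 'a)"
  proof (cases "n < s")
    case True
    then show ?thesis by (simp add: nth fps_X_power_mult_nth)
  next
    case False
    then show ?thesis
      by (simp add: nth fps_X_power_mult_nth stirling_gf_def binomial_fact field_simps)
  qed
qed

lemma bernoulli_gf_mult_stirling_gf:
  "bernoulli_gf s y * stirling_gf s = (fps_exp y :: 'a::field_char_0 fps)"
proof -
  let ?q = "(fps_X / (fps_exp 1 - 1)) ^ s :: 'a fps"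
  \<comment> \<open>As \<open>fps_exp 1 - 1\<close> is not a unit, the factor
    \<open>fps_X ^ s\<close> is put in front and cancelled at the end.\<close>
  have "fps_X ^ s * (?q * stirling_gf s) = ?q * (fps_exp 1 - 1) ^ s"
    by (simp flip: fps_X_power_mult_stirling_gf add: ac_simps)
  also have "\<dots> = fps_X ^ s"
    by (simp only: fps_X_div_exp_minus_1 flip: power_mult_distrib)
  finally have "?q * stirling_gf s = 1"
    by simp
  then show ?thesis
    by (simp add: bernoulli_gf_def ac_simps)
qed

text \<open>At x = 0 the factor c^(rxt) is 1, whether the base is c or e.\<close>

lemma multi_poly_euler_gf_eq_mult_exp:
  fixes x :: "'a::real_field"
  shows "multi_poly_euler_gf k x a b c
    = multi_poly_euler_gf k 0 a b (exp 1) * fps_exp (x * of_nat (length k) * of_real (ln c))"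
  by (simp add: multi_poly_euler_gf_def fps_powr_def mult.commute)

theorem theorem2p4:
  fixes r s n :: nat and k :: "int list" and a b c :: real and x :: "'a::real_normed_field"
  assumes "r \<ge> 1" and "length k = r" and "a > 0" and "b > 0" and "c > 0"
  shows "(\<lambda>m. of_nat (n choose m) *
            (\<Sum>l = 0..n - m. of_nat ((n - m) choose l) / of_nat ((l + s) choose l) *
               of_nat (Stirling (l + s) s) *
               multi_poly_euler_e k (n - m - l) 0 a b *
               higher_bernoulli s m (x * of_nat r * of_real (ln c))))
         sums multi_poly_euler k n x a b c"
proof -
  define y :: 'a where "y = x * of_nat r * of_real (ln c)"
  define E :: "'a fps" where "E = multi_poly_euler_gf k 0 a b (exp 1)"
  let ?f = "\<lambda>m. of_nat (n choose m) *
            (\<Sum>l = 0..n - m. of_nat ((n - m) choose l) / of_nat ((l + s) choose l) *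
               of_nat (Stirling (l + s) s) *
               multi_poly_euler_e k (n - m - l) 0 a b * higher_bernoulli s m y)"
  \<comment> \<open>The two binomials multiply to n!/(m! l! (n-m-l)!), whose denominator is split
    among the three exponential generating functions.\<close>
  have f: "?f m = fact n * (fps_nth (bernoulli_gf s y) m * fps_nth (stirling_gf s * E) (n - m))"
    if "m \<le> n" for m
    unfolding fps_mult_nth sum_distrib_left
  proof (rule sum.cong)
    fix l assume "l \<in> {0..n - m}"
    then have l: "l \<le> n - m" by simp
    show "of_nat (n choose m) * (of_nat ((n - m) choose l) / of_nat ((l + s) choose l) *
        of_nat (Stirling (l + s) s) * multi_poly_euler_e k (n - m - l) 0 a b * higher_bernoulli s m y)
      = fact n * (fps_nth (bernoulli_gf s y) m * (fps_nth (stirling_gf s) l * fps_nth E (n - m - l)))"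
      by (simp add: binomial_fact[OF that, where 'a = 'a] binomial_fact[OF l, where 'a = 'a]
          stirling_gf_def multi_poly_euler_def higher_bernoulli_def E_def ac_simps)
  qed simp
  have "multi_poly_euler_gf k x a b c = bernoulli_gf s y * (stirling_gf s * E)"
    unfolding multi_poly_euler_gf_eq_mult_exp[of k x] assms(2)
    by (simp add: E_def y_def ac_simps flip: bernoulli_gf_mult_stirling_gf[of s])
  then have "multi_poly_euler k n x a b c =
      (\<Sum>m = 0..n. fact n * (fps_nth (bernoulli_gf s y) m * fps_nth (stirling_gf s * E) (n - m)))"
    by (simp only: multi_poly_euler_def fps_mult_nth[of "bernoulli_gf s y"] sum_distrib_left)
  also have "\<dots> = (\<Sum>m = 0..n. ?f m)"
    by (rule sum.cong[OF refl], rule f[symmetric]) simp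
  finally have "multi_poly_euler k n x a b c = (\<Sum>m = 0..n. ?f m)" .
  \<comment> \<open>For m > n the factor \<open>n choose m\<close> is 0, so the series is a finite
    sum.\<close>
  moreover have "?f sums (\<Sum>m = 0..n. ?f m)"
    by (rule sums_finite) auto
  ultimately show ?thesis
    by (simp add: y_def)
qed

end
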